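(* For every integer $r\ge4$, the Balaban index of the third type of rectangular hex derived network $RHDN3(r)$ (dimensions $r=s$) is $$J(RHDN3(r))=\frac{19-40r+21r^2}{315\,(15-28r+14r^2)}\Big(3\big(280+420\sqrt2-70\sqrt5+60\sqrt7-231\sqrt{10}+5\sqrt{14}+6\sqrt{70}\big)+7\big(-157-180\sqrt2+12\sqrt5+54\sqrt{10}\big)r+105\,(5+3\sqrt2)\,r^2\Big).$$
   Context: All graphs are finite, simple and undirected; $\kappa(p)$ denotes the degree of a vertex $p$ in a graph $G$. Rectangular (parallelogram-shaped) hexagonal mesh of dimension $r\times r$: the graph with vertex set $\{1,\dots,r\}^2$, two vertices being adjacent iff their difference is one of $\pm(1,0),\pm(0,1),\pm(1,-1)$. Third type of rectangular hex derived network $RHDN3(r)=RHDN3(r,r)$: obtained from this mesh by replacing each $K_3$ subgraph (triangle) by a planar octahedron, once. That is, for each triangle with vertices $a,b,c$, all edges of the triangle are kept, three new vertices $u_{ab},u_{bc},u_{ca}$ (private to that triangle) are added, the new vertices are made pairwise adjacent, and $u_{ab}$ is joined to $a$ and $b$, $u_{bc}$ to $b$ and $c$, $u_{ca}$ to $c$ and $a$. It has $7r^2-12r+6$ vertices. Balaban index (in the sense used here): for a graph $G$, $$J(G)=\frac{|E(G)|}{|E(G)|-|V(G)|+2}\sum_{pq\in E(G)}\frac{1}{\sqrt{\kappa(p)\,\kappa(q)}}.$$ *)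

theory Defs
  imports Complex_Main "HOL-Library.Product_Plus"
begin

record 'a graph =
  verts :: "'a set"
  edges :: "'a set set"

definition simple_graph :: "'a graph \<Rightarrow> bool" where
  "simple_graph G \<longleftrightarrow> finite (verts G) \<and> (\<forall>e\<in>edges G. e \<subseteq> verts G \<and> card e = 2)"

definition degree :: "'a graph \<Rightarrow> 'a \<Rightarrow> nat" where
  "degree G p = card {e \<in> edges G. p \<in> e}"

(* In a simple graph an edge is e = {p, q} with p \<noteq> q, so the product over e is the product
   of the degrees of its two endpoints. *)
definition balaban_index :: "'a graph \<Rightarrow> real" where
  "balaban_index G =
     real (card (edges G)) / (real (card (edges G)) - real (card (verts G)) + 2) *
     (\<Sum>e\<in>edges G. 1 / sqrt (\<Prod>p\<in>e. real (degree G p)))"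

definition hex_mesh :: "nat \<Rightarrow> (int \<times> int) graph" where
  "hex_mesh r =
     (let V = {1..int r} \<times> {1..int r} in
      \<lparr>verts = V,
       edges = {{p, q} | p q. p \<in> V \<and> q \<in> V \<and>
                  q - p \<in> {(1, 0), (-1, 0), (0, 1), (0, -1), (1, -1), (-1, 1)}}\<rparr>)"

definition pairs :: "'a set \<Rightarrow> 'a set set" where
  "pairs t = {e. e \<subseteq> t \<and> card e = 2}"

definition triangles :: "'a graph \<Rightarrow> 'a set set" where
  "triangles G = {t. t \<subseteq> verts G \<and> card t = 3 \<and> pairs t \<subseteq> edges G}"

(* Mid t {a, b} is the new vertex attached to the side {a, b} of the triangle t; carrying t
   makes it private to t, so an edge shared by two triangles gives rise to two new vertices. *)
datatype 'a vertex = Old 'a | Mid "'a set" "'a set"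

definition octahedral_derived :: "'a graph \<Rightarrow> 'a vertex graph" where
  "octahedral_derived G =
     \<lparr>verts = Old ` verts G \<union> {Mid t e | t e. t \<in> triangles G \<and> e \<in> pairs t},
      edges = {{Old a, Old b} | a b. {a, b} \<in> edges G}
        \<union> {{Mid t e, Old a} | t e a. t \<in> triangles G \<and> e \<in> pairs t \<and> a \<in> e}
        \<union> {{Mid t e, Mid t f} | t e f. t \<in> triangles G \<and> e \<in> pairs t \<and> f \<in> pairs t \<and> e \<noteq> f}\<rparr>"

definition RHDN3 :: "nat \<Rightarrow> (int \<times> int) vertex graph" where
  "RHDN3 r = octahedral_derived (hex_mesh r)"

lemma simple_graph_hex_mesh: "simple_graph (hex_mesh r)"
  by (auto simp: simple_graph_def hex_mesh_def Let_def card_insert_if)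

lemma simple_graph_octahedral_derived:
  assumes "simple_graph G"
  shows "simple_graph (octahedral_derived G)"
proof -
  have fin: "finite (verts G)"
    and ed: "\<And>e. e \<in> edges G \<Longrightarrow> e \<subseteq> verts G \<and> card e = 2"
    using assms by (auto simp: simple_graph_def)
  have "{Mid t e | t e. t \<in> triangles G \<and> e \<in> pairs t}
      \<subseteq> (\<lambda>(t, e). Mid t e) ` (Pow (verts G) \<times> Pow (verts G))"
    by (auto simp: triangles_def pairs_def image_iff)
  then have "finite {Mid t e | t e. t \<in> triangles G \<and> e \<in> pairs t}"
    by (rule finite_subset) (use fin in auto)
  moreover have "\<And>a b. {a, b} \<in> edges G \<Longrightarrow> a \<in> verts G \<and> b \<in> verts G \<and> a \<noteq> b"
    using ed by fastforce
  moreover have "\<And>t e a. t \<in> triangles G \<Longrightarrow> e \<in> pairs t \<Longrightarrow> a \<in> e \<Longrightarrow> a \<in> verts G"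
    by (auto simp: triangles_def pairs_def)
  ultimately show ?thesis
    using fin by (auto simp: simple_graph_def octahedral_derived_def card_insert_if)
qed

lemma simple_graph_RHDN3: "simple_graph (RHDN3 r)"
  unfolding RHDN3_def
  by (rule simple_graph_octahedral_derived[OF simple_graph_hex_mesh])

end

theory Submission
  imports Defs
begin

text \<open>
  The octahedral construction is local, so it can be analysed for an arbitrary graph \<open>G\<close> first. A
  new vertex always has degree 4: two new neighbours and the two ends of its side. An old vertex
  \<open>a\<close> keeps its neighbours in \<open>G\<close> and gains two new ones in each triangle through \<open>a\<close>, since two of
  the three sides of a triangle meet at each corner. The edges of the derived graph are the
  old edges, the edges from a new vertex to an end of its side, and the three edges among
  the new vertices of a triangle. Both the degrees and the Balaban sum come from one formula
  for sums over these three families, \<open>sum_edges_octahedral_derived\<close>; it reduces the Balaban sum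
  to a sum over the old edges, a sum over the old vertices weighted by the number of incident
  triangles, and \<open>3/4\<close> for each triangle (\<open>sum_edges_balaban_octahedral_derived\<close>).

  The unit squares of the grid are cut by the direction \<open>(1, -1)\<close> into an upward and a
  downward triangle, and the mesh has no others (\<open>triangles_hex_mesh\<close>). The corners \<open>(1, 1)\<close> and
  \<open>(r, r)\<close> have mesh degree 2 and lie in one triangle, \<open>(1, r)\<close> and \<open>(r, 1)\<close> have degree 3 and two
  triangles, the other boundary vertices 4 and 3, the inner vertices 6 and 6.
  The degrees in \<open>RHDN3 r\<close> are therefore 4, 7, 10 and 18.

  What is left are sums over rectangular grids (of vertices, and of edges in each of the three
  directions) whose terms depend only on whether each coordinate is first, last or in between; such
  a sum has nine distinct terms, and \<open>sum_grid\<close> evaluates it. This is where the square roots come from: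
  an edge contributes \<open>1 / sqrt (d * d')\<close> with \<open>d\<close> and \<open>d'\<close> among 4, 7, 10 and 18.
\<close>

section \<open>Pairs\<close>

lemma card_pairs: "finite A \<Longrightarrow> card (pairs A) = card A choose 2"
  unfolding pairs_def by (rule n_subsets)

lemma finite_pairs: "finite A \<Longrightarrow> finite (pairs A)"
  unfolding pairs_def by auto

lemma card_pairs_3:
  assumes "card A = 3"
  shows "card (pairs A) = 3"
proof -
  have "finite A" using assms card.infinite by fastforce
  then show ?thesis using assms by (simp add: card_pairs choose_two)
qed

lemma card_pairs_containing:
  assumes "finite A" "a \<in> A"
  shows "card {e \<in> pairs A. a \<in> e} = card A - 1"
proof -
  have "{e \<in> pairs A. a \<in> e} = (\<lambda>b. {a, b}) ` (A - {a})"
    using assms by (auto simp: pairs_def card_2_iff image_iff doubleton_eq_iff)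
  moreover have "inj_on (\<lambda>b. {a, b}) (A - {a})"
    by (auto simp: inj_on_def doubleton_eq_iff)
  ultimately show ?thesis using assms by (simp add: card_image)
qed

section \<open>The octahedral derived graph\<close>

lemma finite_triangles: "finite (verts G) \<Longrightarrow> finite (triangles G)"
  by (rule finite_subset[of _ "Pow (verts G)"]) (auto simp: triangles_def)

lemma finite_edges: "simple_graph G \<Longrightarrow> finite (edges G)"
  by (rule finite_subset[of _ "Pow (verts G)"]) (auto simp: simple_graph_def)

lemma finite_triangle: "t \<in> triangles G \<Longrightarrow> finite t"
  by (auto simp: triangles_def intro: card_ge_0_finite)

text \<open>The three families are disjoint because they differ in how many of their ends are new, and each
  is indexed without repetition: an edge between a new and an old vertex by its
  triangle, side and end; an edge between two new vertices, because these carry their triangle, by that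
  triangle and a pair of its sides. So sums over the edges turn into iterated sums. The codomain
  is general because counting edges and degrees are instances as well as the Balaban sum.\<close>

lemma sum_edges_octahedral_derived:
  fixes f :: "'a vertex set \<Rightarrow> 'b::comm_monoid_add"
  assumes G: "simple_graph G"
  shows "sum f (edges (octahedral_derived G)) =
    (\<Sum>e\<in>edges G. f (Old ` e))
    + (\<Sum>t\<in>triangles G. \<Sum>e\<in>pairs t. \<Sum>a\<in>e. f {Mid t e, Old a})
    + (\<Sum>t\<in>triangles G. \<Sum>p\<in>pairs (pairs t). f (Mid t ` p))"
proof -
  let ?T = "triangles G"
  let ?A = "(\<lambda>e. Old ` e) ` edges G"
  let ?I = "Sigma ?T (\<lambda>t. Sigma (pairs t) (\<lambda>e. e))"
  let ?B = "(\<lambda>(t, e, a). {Mid t e, Old a}) ` ?I"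
  let ?J = "Sigma ?T (\<lambda>t. pairs (pairs t))"
  let ?C = "(\<lambda>(t, p). Mid t ` p) ` ?J"
  have finT: "finite ?T" using G by (simp add: simple_graph_def finite_triangles)
  have fint: "finite t" if "t \<in> ?T" for t using that by (rule finite_triangle)
  have fine: "finite e" if "e \<in> pairs t" for t and e :: "'a set"
    using that by (auto simp: pairs_def intro: card_ge_0_finite)
  have finI: "finite ?I"
    by (intro finite_SigmaI finT finite_pairs) (auto intro: fint fine)
  have finJ: "finite ?J"
    by (intro finite_SigmaI finT finite_pairs fint)
  have e2: "card e = 2" if "e \<in> edges G" for e
    using G that by (auto simp: simple_graph_def)
  have A: "?A = {{Old a, Old b} | a b. {a, b} \<in> edges G}"
  proof (intro equalityI subsetI)
    fix x assume "x \<in> ?A"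
    then obtain e where e: "e \<in> edges G" "x = Old ` e" by auto
    then obtain a b where "e = {a, b}" using e2[of e] by (auto simp: card_2_iff)
    then show "x \<in> {{Old a, Old b} | a b. {a, b} \<in> edges G}" using e by auto
  next
    fix x assume "x \<in> {{Old a, Old b :: 'a vertex} | a b. {a, b} \<in> edges G}"
    then obtain a b where "{a, b} \<in> edges G" "x = Old ` {a, b}" by auto
    then show "x \<in> ?A" by blast
  qed
  have B: "?B = {{Mid t e, Old a} | t e a. t \<in> ?T \<and> e \<in> pairs t \<and> a \<in> e}"
    by (auto simp: image_iff)
  have C: "?C = {{Mid t e, Mid t f} | t e f. t \<in> ?T \<and> e \<in> pairs t \<and> f \<in> pairs t \<and> e \<noteq> f}"
  proof (intro equalityI subsetI)
    fix x assume "x \<in> ?C"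
    then obtain t p where p: "t \<in> ?T" "p \<subseteq> pairs t" "card p = 2" "x = Mid t ` p"
      by (auto simp: pairs_def[of "pairs _"])
    then obtain e f where "p = {e, f}" "e \<noteq> f" by (auto simp: card_2_iff)
    then show "x \<in> {{Mid t e, Mid t f} | t e f. t \<in> ?T \<and> e \<in> pairs t \<and> f \<in> pairs t \<and> e \<noteq> f}"
      using p by auto
  next
    fix x
    assume "x \<in> {{Mid t e, Mid t f} | t e f. t \<in> ?T \<and> e \<in> pairs t \<and> f \<in> pairs t \<and> e \<noteq> f}"
    then obtain t e f where h: "t \<in> ?T" "e \<in> pairs t" "f \<in> pairs t" "e \<noteq> f"
      and x: "x = Mid t ` {e, f}" by auto
    have "{e, f} \<in> pairs (pairs t)" using h by (simp add: pairs_def[of "pairs _"])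
    then show "x \<in> ?C" using h(1) x by blast
  qed
  have E: "edges (octahedral_derived G) = ?A \<union> ?B \<union> ?C"
    unfolding A B C by (simp add: octahedral_derived_def)
  have finA: "finite ?A" using finite_edges[OF G] by simp
  have disj: "?A \<inter> ?B = {}" "(?A \<union> ?B) \<inter> ?C = {}"
    unfolding A B C by (auto simp: doubleton_eq_iff)
  have injA: "inj_on ((`) Old) (edges G)"
    by (auto simp: inj_on_def inj_image_eq_iff inj_def)
  have injB: "inj_on (\<lambda>(t, e, a). {Mid t e, Old a}) ?I"
    by (auto simp: inj_on_def doubleton_eq_iff)
  have injC: "inj_on (\<lambda>(t, p). Mid t ` p) ?J"
  proof (clarsimp simp: inj_on_def)
    fix t p t' p'
    assume p: "p \<in> pairs (pairs t)" and eq: "Mid t ` p = Mid t' ` p'"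
    \<comment> \<open>The pair is nonempty, and any new vertex in it names the triangle.\<close>
    from p obtain e where "e \<in> p" by (auto simp: pairs_def[of "pairs _"] card_2_iff)
    then have "Mid t e \<in> Mid t' ` p'" using eq by blast
    then have "t = t'" by auto
    then show "t = t' \<and> p = p'"
      using eq by (simp add: inj_image_eq_iff inj_def)
  qed
  have "sum f (edges (octahedral_derived G)) = sum f ?A + sum f ?B + sum f ?C"
    unfolding E using finA finI finJ disj by (simp add: sum.union_disjoint)
  moreover have "sum f ?A = (\<Sum>e\<in>edges G. f (Old ` e))"
    using injA by (simp add: sum.reindex)
  moreover have "sum f ?B = (\<Sum>t\<in>?T. \<Sum>e\<in>pairs t. \<Sum>a\<in>e. f {Mid t e, Old a})"
  proof -
    have "sum f ?B = (\<Sum>(t, e, a)\<in>?I. f {Mid t e, Old a})"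
      using injB by (simp add: sum.reindex case_prod_unfold)
    also have "\<dots> = (\<Sum>t\<in>?T. \<Sum>(e, a)\<in>Sigma (pairs t) (\<lambda>e. e). f {Mid t e, Old a})"
      by (subst sum.Sigma) (auto intro: finT finite_SigmaI finite_pairs fint fine simp: case_prod_unfold)
    also have "\<dots> = (\<Sum>t\<in>?T. \<Sum>e\<in>pairs t. \<Sum>a\<in>e. f {Mid t e, Old a})"
      by (intro sum.cong refl sum.Sigma[symmetric]) (auto intro: finite_pairs fint fine)
    finally show ?thesis .
  qed
  moreover have "sum f ?C = (\<Sum>t\<in>?T. \<Sum>p\<in>pairs (pairs t). f (Mid t ` p))"
  proof -
    have "sum f ?C = (\<Sum>(t, p)\<in>?J. f (Mid t ` p))"
      using injC by (simp add: sum.reindex case_prod_unfold)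
    also have "\<dots> = (\<Sum>t\<in>?T. \<Sum>p\<in>pairs (pairs t). f (Mid t ` p))"
      by (intro sum.Sigma[symmetric]) (auto intro: finT finite_pairs fint)
    finally show ?thesis .
  qed
  ultimately show ?thesis by simp
qed

lemma degree_eq_sum:
  assumes "finite (edges G)"
  shows "degree G v = (\<Sum>e\<in>edges G. if v \<in> e then 1 else 0)"
  using assms by (simp add: degree_def sum.If_cases Int_def)

definition triangle_count :: "'a graph \<Rightarrow> 'a \<Rightarrow> nat" where
  "triangle_count G a = card {t \<in> triangles G. a \<in> t}"

lemma sum_pairs_sum:
  fixes g :: "'a \<Rightarrow> 'b::semiring_1"
  assumes "finite t"
  shows "(\<Sum>e\<in>pairs t. \<Sum>a\<in>e. g a) = of_nat (card t - 1) * (\<Sum>a\<in>t. g a)"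
proof -
  have "(\<Sum>e\<in>pairs t. \<Sum>a\<in>e. g a) = (\<Sum>e\<in>pairs t. \<Sum>a\<in>{a\<in>t. a \<in> e}. g a)"
    by (intro sum.cong) (auto simp: pairs_def)
  also have "\<dots> = (\<Sum>a\<in>t. \<Sum>e\<in>{e\<in>pairs t. a \<in> e}. g a)"
    using assms finite_pairs[OF assms] by (rule sum.swap_restrict[OF _ _, rotated])
  also have "\<dots> = (\<Sum>a\<in>t. of_nat (card t - 1) * g a)"
    using assms by (intro sum.cong) (auto simp: card_pairs_containing)
  finally show ?thesis by (simp add: sum_distrib_left)
qed

text \<open>Double counting of flags: the left side visits each corner of a triangle once for each of the
  two sides through it.\<close>

lemma sum_triangle_corners:
  fixes g :: "'a \<Rightarrow> 'b::semiring_1"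
  assumes "finite (verts G)"
  shows "(\<Sum>t\<in>triangles G. \<Sum>e\<in>pairs t. \<Sum>a\<in>e. g a)
    = 2 * (\<Sum>a\<in>verts G. of_nat (triangle_count G a) * g a)"
proof -
  have "(\<Sum>t\<in>triangles G. \<Sum>e\<in>pairs t. \<Sum>a\<in>e. g a)
      = (\<Sum>t\<in>triangles G. 2 * (\<Sum>a\<in>t. g a))"
  proof (intro sum.cong refl)
    fix t assume t: "t \<in> triangles G"
    then have "card t = 3" by (simp add: triangles_def)
    then show "(\<Sum>e\<in>pairs t. \<Sum>a\<in>e. g a) = 2 * (\<Sum>a\<in>t. g a)"
      using sum_pairs_sum[OF finite_triangle[OF t], of g] by simp
  qed
  also have "\<dots> = 2 * (\<Sum>t\<in>triangles G. \<Sum>a\<in>t. g a)"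
    by (simp add: sum_distrib_left)
  also have "(\<Sum>t\<in>triangles G. \<Sum>a\<in>t. g a)
      = (\<Sum>t\<in>triangles G. \<Sum>a\<in>{a\<in>verts G. a \<in> t}. g a)"
    by (intro sum.cong refl) (auto simp: triangles_def)
  also have "\<dots>
      = (\<Sum>a\<in>verts G. \<Sum>t\<in>{t\<in>triangles G. a \<in> t}. g a)"
    using assms finite_triangles[OF assms] by (rule sum.swap_restrict[OF _ _, rotated])
  finally show ?thesis by (simp add: triangle_count_def)
qed

text \<open>Summing the indicator of membership of \<open>Old a\<close> over all edges: the old edges give the degree in
  \<open>G\<close>, the mixed edges give two for each triangle through \<open>a\<close>.\<close>

lemma degree_Old:
  assumes G: "simple_graph G" and a: "a \<in> verts G"
  shows "degree (octahedral_derived G) (Old a) = degree G a + 2 * triangle_count G a"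
proof -
  have fin: "finite (verts G)" using G by (simp add: simple_graph_def)
  have "degree (octahedral_derived G) (Old a) =
      (\<Sum>e\<in>edges G. if a \<in> e then 1 else 0)
      + (\<Sum>t\<in>triangles G. \<Sum>e\<in>pairs t. \<Sum>b\<in>e. if b = a then 1 else 0)"
    unfolding degree_eq_sum[OF finite_edges[OF simple_graph_octahedral_derived[OF G]]]
      sum_edges_octahedral_derived[OF G]
    by (simp add: image_iff eq_commute)
  also have "\<dots> = degree G a + 2 * triangle_count G a"
    unfolding sum_triangle_corners[OF fin] degree_eq_sum[OF finite_edges[OF G]]
    using a fin by (simp add: sum.If_cases if_distrib cong: if_cong)
  finally show ?thesis .
qed

text \<open>Two incident edges lead to the ends of the side \<open>e\<close>. The other two correspond to the pairs of sides
  that contain \<open>e\<close>, that is, to the two other sides of \<open>t\<close>.\<close>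

lemma degree_Mid:
  assumes G: "simple_graph G" and t: "t \<in> triangles G" and e: "e \<in> pairs t"
  shows "degree (octahedral_derived G) (Mid t e) = 4"
proof -
  have fin: "finite (triangles G)" using G by (simp add: simple_graph_def finite_triangles)
  have t3: "card (pairs t) = 3" using t by (simp add: triangles_def card_pairs_3)
  have finp: "finite (pairs t)" using t by (simp add: finite_pairs finite_triangle)
  have "degree (octahedral_derived G) (Mid t e) =
      (\<Sum>t'\<in>triangles G. \<Sum>e'\<in>pairs t'. \<Sum>a\<in>e'. if t = t' \<and> e = e' then 1 else 0)
      + (\<Sum>t'\<in>triangles G. \<Sum>p\<in>pairs (pairs t'). if t = t' \<and> e \<in> p then 1 else 0)"
    unfolding degree_eq_sum[OF finite_edges[OF simple_graph_octahedral_derived[OF G]]]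
      sum_edges_octahedral_derived[OF G]
    by (intro arg_cong2[where f = "(+)"] sum.cong refl) (auto simp: image_iff)
  also have "(\<Sum>t'\<in>triangles G. \<Sum>e'\<in>pairs t'. \<Sum>a\<in>e'. if t = t' \<and> e = e' then 1 else 0)
      = (\<Sum>t'\<in>triangles G. if t = t' then \<Sum>e'\<in>pairs t. if e = e' then card e else 0 else 0)"
    by (intro sum.cong refl) (auto intro!: sum.cong)
  also have "\<dots> = 2" using t e fin finp by (simp add: pairs_def)
  also have "(\<Sum>t'\<in>triangles G. \<Sum>p\<in>pairs (pairs t'). if t = t' \<and> e \<in> p then 1 else 0)
      = (\<Sum>t'\<in>triangles G. if t = t' then \<Sum>p\<in>pairs (pairs t). if e \<in> p then 1 else 0 else 0)"
    by (intro sum.cong refl) (auto intro!: sum.cong)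
  also have "\<dots> = card {p \<in> pairs (pairs t). e \<in> p}"
    using t fin finite_pairs[OF finp] by (simp add: sum.If_cases Int_def)
  also have "\<dots> = 2" using card_pairs_containing[OF finp e] t3 by simp
  finally show ?thesis by simp
qed

lemma card_verts_octahedral_derived:
  assumes G: "simple_graph G"
  shows "card (verts (octahedral_derived G)) = card (verts G) + 3 * card (triangles G)"
proof -
  let ?M = "(\<lambda>(t, e). Mid t e) ` Sigma (triangles G) pairs"
  have fin: "finite (verts G)" using G by (simp add: simple_graph_def)
  have finT: "finite (triangles G)" using fin by (rule finite_triangles)
  have finS: "finite (Sigma (triangles G) pairs)"
    by (intro finite_SigmaI finT finite_pairs finite_triangle)
  have V: "verts (octahedral_derived G) = Old ` verts G \<union> ?M"
    by (auto simp: octahedral_derived_def)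
  have "card ?M = card (Sigma (triangles G) pairs)"
    by (rule card_image) (auto simp: inj_on_def)
  also have "\<dots> = (\<Sum>t\<in>triangles G. card (pairs t))"
    by (rule card_SigmaI) (auto intro: finT finite_pairs finite_triangle)
  also have "\<dots> = 3 * card (triangles G)"
    by (simp add: triangles_def card_pairs_3)
  finally have "card ?M = 3 * card (triangles G)" .
  moreover have "card (Old ` verts G) = card (verts G)"
    by (rule card_image) (auto simp: inj_on_def)
  moreover have "card (verts (octahedral_derived G)) = card (Old ` verts G) + card ?M"
    unfolding V using fin finS by (intro card_Un_disjoint) auto
  ultimately show ?thesis by simp
qed

lemma card_edges_octahedral_derived:
  assumes G: "simple_graph G"
  shows "card (edges (octahedral_derived G)) = card (edges G) + 9 * card (triangles G)"
proof -
  have 2: "(\<Sum>e\<in>pairs t. card e) = 6" if "t \<in> triangles G" for t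
  proof -
    have "(\<Sum>e\<in>pairs t. card e) = (\<Sum>e\<in>pairs t. 2)"
      by (intro sum.cong) (auto simp: pairs_def)
    then show ?thesis using that by (simp add: triangles_def card_pairs_3)
  qed
  have 3: "card (pairs (pairs t)) = 3" if "t \<in> triangles G" for t
    using that by (simp add: triangles_def card_pairs_3)
  show ?thesis
    unfolding card_eq_sum sum_edges_octahedral_derived[OF G]
    using 2 3 by simp
qed

text \<open>A mixed edge at \<open>a\<close> contributes \<open>1 / sqrt (4 * d a)\<close>, and \<open>a\<close> has two of them in each of its
  triangles; the factors 2 cancel. Each triangle has three edges between new vertices, with
  contribution \<open>1 / sqrt (4 * 4)\<close> each.\<close>

lemma sum_edges_balaban_octahedral_derived:
  fixes G :: "'a graph" and d :: "'a \<Rightarrow> nat"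
  assumes G: "simple_graph G"
    and d: "\<And>a. a \<in> verts G \<Longrightarrow> degree (octahedral_derived G) (Old a) = d a"
  shows "(\<Sum>e\<in>edges (octahedral_derived G).
      1 / sqrt (\<Prod>p\<in>e. real (degree (octahedral_derived G) p))) =
    (\<Sum>e\<in>edges G. 1 / sqrt (\<Prod>p\<in>e. real (d p)))
    + (\<Sum>a\<in>verts G. real (triangle_count G a) / sqrt (real (d a)))
    + 3 / 4 * real (card (triangles G))"
proof -
  let ?D = "degree (octahedral_derived G)"
  have fin: "finite (verts G)" using G by (simp add: simple_graph_def)
  have "(\<Sum>e\<in>edges G. 1 / sqrt (\<Prod>p\<in>Old ` e. real (?D p)))
      = (\<Sum>e\<in>edges G. 1 / sqrt (\<Prod>p\<in>e. real (d p)))"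
  proof (intro sum.cong refl)
    fix e assume "e \<in> edges G"
    then have "e \<subseteq> verts G" using G by (auto simp: simple_graph_def)
    then have "(\<Prod>p\<in>e. real (?D (Old p))) = (\<Prod>p\<in>e. real (d p))"
      by (intro prod.cong) (auto simp: d)
    then show "1 / sqrt (\<Prod>p\<in>Old ` e. real (?D p)) = 1 / sqrt (\<Prod>p\<in>e. real (d p))"
      by (simp add: prod.reindex inj_on_def)
  qed
  moreover have "(\<Sum>t\<in>triangles G. \<Sum>e\<in>pairs t. \<Sum>a\<in>e.
        1 / sqrt (\<Prod>p\<in>{Mid t e, Old a}. real (?D p)))
      = (\<Sum>a\<in>verts G. real (triangle_count G a) / sqrt (real (d a)))"
  proof -
    have "(\<Sum>t\<in>triangles G. \<Sum>e\<in>pairs t. \<Sum>a\<in>e.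
          1 / sqrt (\<Prod>p\<in>{Mid t e, Old a}. real (?D p)))
        = (\<Sum>t\<in>triangles G. \<Sum>e\<in>pairs t. \<Sum>a\<in>e. 1 / (2 * sqrt (real (d a))))"
    proof (intro sum.cong refl)
      fix t e a assume h: "t \<in> triangles G" "e \<in> pairs t" "a \<in> e"
      then have "a \<in> verts G" by (auto simp: triangles_def pairs_def)
      then show "1 / sqrt (\<Prod>p\<in>{Mid t e, Old a}. real (?D p)) = 1 / (2 * sqrt (real (d a)))"
        using h by (simp add: degree_Mid[OF G] d real_sqrt_mult)
    qed
    then show ?thesis
      unfolding sum_triangle_corners[OF fin] by (simp add: sum_distrib_left)
  qed
  moreover have "(\<Sum>t\<in>triangles G. \<Sum>p\<in>pairs (pairs t).
        1 / sqrt (\<Prod>p\<in>Mid t ` p. real (?D p))) = 3 / 4 * real (card (triangles G))"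
  proof -
    have "(\<Sum>t\<in>triangles G. \<Sum>p\<in>pairs (pairs t). 1 / sqrt (\<Prod>p\<in>Mid t ` p. real (?D p)))
        = (\<Sum>t\<in>triangles G. \<Sum>p\<in>pairs (pairs t). 1 / 4 :: real)"
    proof (intro sum.cong refl)
      fix t p assume t: "t \<in> triangles G" and "p \<in> pairs (pairs t)"
      then have p: "p \<subseteq> pairs t" "card p = 2" by (auto simp: pairs_def[of "pairs _"])
      have "(\<Prod>e\<in>p. real (?D (Mid t e))) = (\<Prod>e\<in>p. 4)"
        using p by (intro prod.cong) (auto simp: degree_Mid[OF G t])
      then show "1 / sqrt (\<Prod>p\<in>Mid t ` p. real (?D p)) = 1 / 4"
        using p by (simp add: prod.reindex inj_on_def)
    qed
    also have "\<dots> = (\<Sum>t\<in>triangles G. 3 / 4)"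
      by (intro sum.cong) (auto simp: triangles_def card_pairs_3)
    finally show ?thesis by simp
  qed
  ultimately show ?thesis
    unfolding sum_edges_octahedral_derived[OF G] by simp
qed

section \<open>The hexagonal mesh\<close>

definition hex_directions :: "(int \<times> int) set" where
  "hex_directions = {(1, 0), (-1, 0), (0, 1), (0, -1), (1, -1), (-1, 1)}"

lemma verts_hex_mesh: "verts (hex_mesh r) = {1..int r} \<times> {1..int r}"
  by (simp add: hex_mesh_def Let_def)

lemma edge_hex_mesh_iff:
  "{p, q} \<in> edges (hex_mesh r) \<longleftrightarrow>
    p \<in> verts (hex_mesh r) \<and> q \<in> verts (hex_mesh r) \<and> q - p \<in> hex_directions"
proof -
  have sym: "p - q \<in> hex_directions" if "q - p \<in> hex_directions" for p q
  proof -
    obtain u v where "q - p = (u, v)" by (cases "q - p")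
    moreover from this have "p - q = (-u, -v)" by (cases p, cases q) auto
    ultimately show ?thesis using that by (auto simp: hex_directions_def)
  qed
  have "{p, q} \<in> edges (hex_mesh r) \<longleftrightarrow>
      (\<exists>p' q'. {p, q} = {p', q'} \<and> p' \<in> verts (hex_mesh r) \<and> q' \<in> verts (hex_mesh r)
        \<and> q' - p' \<in> hex_directions)"
    by (simp add: hex_mesh_def Let_def hex_directions_def)
  then show ?thesis using sym by (metis doubleton_eq_iff)
qed

text \<open>Choosing one of each two opposite directions makes every edge appear once, based at a grid point,
  which permits summation over index rectangles.\<close>

lemma edges_hex_mesh:
  "edges (hex_mesh r) =
    (\<lambda>(x, y). {(x, y), (x + 1, y)}) ` ({1..int r - 1} \<times> {1..int r})
    \<union> (\<lambda>(x, y). {(x, y), (x, y + 1)}) ` ({1..int r} \<times> {1..int r - 1})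
    \<union> (\<lambda>(x, y). {(x + 1, y), (x, y + 1)}) ` ({1..int r - 1} \<times> {1..int r - 1})"
  (is "_ = ?H \<union> ?V \<union> ?D")
proof (intro equalityI subsetI)
  fix e assume "e \<in> edges (hex_mesh r)"
  then obtain p q where e: "e = {p, q}"
    and pq: "p \<in> verts (hex_mesh r)" "q \<in> verts (hex_mesh r)" "q - p \<in> hex_directions"
    by (auto simp: hex_mesh_def Let_def hex_directions_def)
  obtain x y where p: "p = (x, y)" by (cases p)
  obtain dx dy where d: "q - p = (dx, dy)" by (cases "q - p")
  have q: "q = (x + dx, y + dy)" using d p by (cases q) auto
  have H: "{(x, y), (x + 1, y)} \<in> ?H" if "1 \<le> x" "x < int r" "1 \<le> y" "y \<le> int r" for x y
    using that by (intro image_eqI[where x = "(x, y)"]) auto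
  have V: "{(x, y), (x, y + 1)} \<in> ?V" if "1 \<le> x" "x \<le> int r" "1 \<le> y" "y < int r" for x y
    using that by (intro image_eqI[where x = "(x, y)"]) auto
  have D: "{(x + 1, y), (x, y + 1)} \<in> ?D" if "1 \<le> x" "x < int r" "1 \<le> y" "y < int r" for x y
    using that by (intro image_eqI[where x = "(x, y)"]) auto
  have "(dx, dy) \<in> hex_directions" using pq(3) d by simp
  then consider "q = (x + 1, y)" | "q = (x - 1, y)" | "q = (x, y + 1)" | "q = (x, y - 1)"
    | "q = (x + 1, y - 1)" | "q = (x - 1, y + 1)"
    unfolding hex_directions_def using q by auto
  then show "e \<in> ?H \<union> ?V \<union> ?D"
  proof cases
    case 1 then show ?thesis using H[of x y] pq e p by (auto simp: verts_hex_mesh)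
  next
    case 2 then show ?thesis using H[of "x - 1" y] pq e p
      by (simp add: verts_hex_mesh insert_commute)
  next
    case 3 then show ?thesis using V[of x y] pq e p by (auto simp: verts_hex_mesh)
  next
    case 4 then show ?thesis using V[of x "y - 1"] pq e p
      by (simp add: verts_hex_mesh insert_commute)
  next
    case 5 then show ?thesis using D[of x "y - 1"] pq e p
      by (simp add: verts_hex_mesh insert_commute)
  next
    case 6 then show ?thesis using D[of "x - 1" y] pq e p
      by (simp add: verts_hex_mesh insert_commute)
  qed
next
  fix e assume "e \<in> ?H \<union> ?V \<union> ?D"
  then show "e \<in> edges (hex_mesh r)"
    by (auto simp: edge_hex_mesh_iff verts_hex_mesh hex_directions_def)
qed

lemma sum_edges_hex_mesh:
  fixes f :: "(int \<times> int) set \<Rightarrow> 'b::comm_monoid_add"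
  shows "sum f (edges (hex_mesh r)) =
    (\<Sum>x\<in>{1..int r - 1}. \<Sum>y\<in>{1..int r}. f {(x, y), (x + 1, y)})
    + (\<Sum>x\<in>{1..int r}. \<Sum>y\<in>{1..int r - 1}. f {(x, y), (x, y + 1)})
    + (\<Sum>x\<in>{1..int r - 1}. \<Sum>y\<in>{1..int r - 1}. f {(x + 1, y), (x, y + 1)})"
proof -
  have *: "sum f (g ` (A \<times> B)) = (\<Sum>x\<in>A. \<Sum>y\<in>B. f (g (x, y)))"
    if "inj_on g (A \<times> B)" for g and A B :: "int set"
    using that by (simp add: sum.reindex sum.cartesian_product case_prod_unfold)
  show ?thesis
    unfolding edges_hex_mesh
    apply (subst sum.union_disjoint, simp, simp, force simp: doubleton_eq_iff)
    apply (subst sum.union_disjoint, simp, simp, force simp: doubleton_eq_iff)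
    by (subst *, force simp: inj_on_def doubleton_eq_iff)+ simp
qed

definition up_triangle :: "int \<times> int \<Rightarrow> (int \<times> int) set" where
  "up_triangle = (\<lambda>(x, y). {(x, y), (x + 1, y), (x, y + 1)})"

definition down_triangle :: "int \<times> int \<Rightarrow> (int \<times> int) set" where
  "down_triangle = (\<lambda>(x, y). {(x + 1, y), (x, y + 1), (x + 1, y + 1)})"

lemma pairs_3:
  assumes "a \<noteq> b" "a \<noteq> c" "b \<noteq> c"
  shows "pairs {a, b, c} = {{a, b}, {a, c}, {b, c}}"
proof -
  have "{{a, b}, {a, c}, {b, c}} \<subseteq> pairs {a, b, c}"
    using assms by (auto simp: pairs_def)
  moreover have "card {{a, b}, {a, c}, {b, c}} = 3"
    using assms by (auto simp: doubleton_eq_iff card_insert_if)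
  moreover have "card (pairs {a, b, c}) = 3" using assms by (intro card_pairs_3) auto
  ultimately show ?thesis
    by (metis card_subset_eq finite_pairs finite.emptyI finite.insertI)
qed

text \<open>Adjacent vertices differ by at most one in each coordinate, so a triangle fits into a unit square.
  The diagonal of the square in direction \<open>(1, 1)\<close> is not an edge, so one of its ends is missing
  from the triangle, and the three other vertices of the square form the triangle.\<close>

lemma triangles_hex_mesh:
  fixes r :: nat
  defines "B \<equiv> {1..int r - 1} \<times> {1..int r - 1}"
  shows "triangles (hex_mesh r) = up_triangle ` B \<union> down_triangle ` B"
proof (intro equalityI subsetI)
  fix t assume t: "t \<in> triangles (hex_mesh r)"
  then have card: "card t = 3" and tV: "t \<subseteq> verts (hex_mesh r)"
    by (auto simp: triangles_def)
  have fin: "finite t" using t by (rule finite_triangle)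
  have ne: "t \<noteq> {}" using card by auto
  have adj: "q - p \<in> hex_directions" if "p \<in> t" "q \<in> t" "p \<noteq> q" for p q
  proof -
    have "{p, q} \<in> pairs t" using that by (simp add: pairs_def)
    then show ?thesis using t by (auto simp: triangles_def edge_hex_mesh_iff)
  qed
  have close: "fst q \<le> fst p + 1 \<and> snd q \<le> snd p + 1" if "p \<in> t" "q \<in> t" for p q
  proof (cases "p = q")
    case False
    then have "(fst q - fst p, snd q - snd p) \<in> hex_directions"
      using adj[OF that] by (simp add: minus_prod_def)
    then show ?thesis by (auto simp: hex_directions_def)
  qed auto
  define m n where "m = Min (fst ` t)" and "n = Min (snd ` t)"
  have "m \<in> fst ` t" "n \<in> snd ` t"
    unfolding m_def n_def using fin ne by (auto intro!: Min_in simp del: Min_in)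
  then have upper: "fst q \<le> m + 1 \<and> snd q \<le> n + 1" if "q \<in> t" for q
    using close that by fastforce
  have lower: "m \<le> fst q \<and> n \<le> snd q" if "q \<in> t" for q
    unfolding m_def n_def using fin that by auto
  have box: "fst q \<in> {m, m + 1} \<and> snd q \<in> {n, n + 1}" if "q \<in> t" for q
    using upper[OF that] lower[OF that] by auto
  have diagonal: "(m, n) \<notin> t \<or> (m + 1, n + 1) \<notin> t"
    using adj[of "(m, n)" "(m + 1, n + 1)"] by (auto simp: hex_directions_def)
  have sub: "t \<subseteq> up_triangle (m, n) \<or> t \<subseteq> down_triangle (m, n)"
    using diagonal
  proof
    assume "(m, n) \<notin> t"
    then have "t \<subseteq> down_triangle (m, n)" using box by (fastforce simp: down_triangle_def)
    then show ?thesis ..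
  next
    assume "(m + 1, n + 1) \<notin> t"
    then have "t \<subseteq> up_triangle (m, n)" using box by (fastforce simp: up_triangle_def)
    then show ?thesis ..
  qed
  have eq: "t = up_triangle (m, n) \<or> t = down_triangle (m, n)"
  proof -
    have "finite (up_triangle (m, n)) \<and> card (up_triangle (m, n)) = 3"
      "finite (down_triangle (m, n)) \<and> card (down_triangle (m, n)) = 3"
      by (simp_all add: up_triangle_def down_triangle_def)
    then show ?thesis using sub card by (metis card_subset_eq)
  qed
  then have "(m + 1, n) \<in> t" "(m, n + 1) \<in> t"
    by (auto simp: up_triangle_def down_triangle_def)
  then have "(m, n) \<in> B" using tV by (auto simp: verts_hex_mesh B_def)
  then show "t \<in> up_triangle ` B \<union> down_triangle ` B" using eq by blast
next
  fix t assume "t \<in> up_triangle ` B \<union> down_triangle ` B"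
  then obtain x y where B: "(x, y) \<in> B" and "t = up_triangle (x, y) \<or> t = down_triangle (x, y)"
    by auto
  then consider "t = {(x, y), (x + 1, y), (x, y + 1)}"
    | "t = {(x + 1, y), (x, y + 1), (x + 1, y + 1)}"
    by (auto simp: up_triangle_def down_triangle_def)
  then show "t \<in> triangles (hex_mesh r)"
    using B
    by cases (simp_all add: triangles_def B_def pairs_3 edge_hex_mesh_iff
        verts_hex_mesh hex_directions_def)
qed

text \<open>The coordinate sums recover the position of a triangle, and modulo 3 its orientation. This gives
  injectivity and disjointness of the two families without comparing three-element sets.\<close>

lemma sum_coordinates_up_triangle:
  "sum fst (up_triangle p) = 3 * fst p + 1" "sum snd (up_triangle p) = 3 * snd p + 1"
  by (simp_all add: up_triangle_def split: prod.split)

lemma sum_coordinates_down_triangle: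
  "sum fst (down_triangle p) = 3 * fst p + 2" "sum snd (down_triangle p) = 3 * snd p + 2"
  by (simp_all add: down_triangle_def split: prod.split)

lemma inj_up_triangle: "inj up_triangle"
proof (rule injI)
  fix p q assume "up_triangle p = up_triangle q"
  then show "p = q"
    using sum_coordinates_up_triangle[of p] sum_coordinates_up_triangle[of q]
    by (simp add: prod_eq_iff)
qed

lemma inj_down_triangle: "inj down_triangle"
proof (rule injI)
  fix p q assume "down_triangle p = down_triangle q"
  then show "p = q"
    using sum_coordinates_down_triangle[of p] sum_coordinates_down_triangle[of q]
    by (simp add: prod_eq_iff)
qed

lemma up_triangle_neq_down_triangle: "up_triangle p \<noteq> down_triangle q"
proof
  assume "up_triangle p = down_triangle q"
  then have "3 * fst p + 1 = 3 * fst q + 2"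
    using sum_coordinates_up_triangle(1)[of p] sum_coordinates_down_triangle(1)[of q] by simp
  then show False by presburger
qed

lemma card_triangles_hex_mesh:
  "card (triangles (hex_mesh r)) = 2 * (r - 1)\<^sup>2"
proof -
  have "nat (int r - 1) = r - 1" by simp
  then show ?thesis
    unfolding triangles_hex_mesh using up_triangle_neq_down_triangle
    by (subst card_Un_disjoint)
     (auto simp: card_image inj_on_subset[OF inj_up_triangle]
       inj_on_subset[OF inj_down_triangle] power2_eq_square)
qed

lemma triangle_count_hex_mesh:
  fixes r :: nat
  defines "B \<equiv> {1..int r - 1} \<times> {1..int r - 1}"
  shows "triangle_count (hex_mesh r) (x, y) =
    card ({(x, y), (x - 1, y), (x, y - 1)} \<inter> B)
    + card ({(x - 1, y), (x, y - 1), (x - 1, y - 1)} \<inter> B)"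
proof -
  have up: "{p \<in> B. (x, y) \<in> up_triangle p} = {(x, y), (x - 1, y), (x, y - 1)} \<inter> B"
    by (auto simp: up_triangle_def)
  have down: "{p \<in> B. (x, y) \<in> down_triangle p} =
      {(x - 1, y), (x, y - 1), (x - 1, y - 1)} \<inter> B"
    by (auto simp: down_triangle_def)
  have "{t \<in> triangles (hex_mesh r). (x, y) \<in> t} =
      up_triangle ` {p \<in> B. (x, y) \<in> up_triangle p}
      \<union> down_triangle ` {p \<in> B. (x, y) \<in> down_triangle p}"
    unfolding triangles_hex_mesh B_def[symmetric] by auto
  moreover have "card (up_triangle ` A) = card A" "card (down_triangle ` A) = card A" for A
    by (simp_all add: card_image inj_on_subset[OF inj_up_triangle]
        inj_on_subset[OF inj_down_triangle])
  moreover have "up_triangle ` A \<inter> down_triangle ` A' = {}" for A A'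
    using up_triangle_neq_down_triangle by auto
  ultimately show ?thesis
    unfolding triangle_count_def up down by (simp add: card_Un_disjoint)
qed

lemma degree_hex_mesh:
  assumes "(x, y) \<in> verts (hex_mesh r)"
  shows "degree (hex_mesh r) (x, y) =
    card ({(x + 1, y), (x - 1, y), (x, y + 1), (x, y - 1), (x + 1, y - 1), (x - 1, y + 1)}
      \<inter> ({1..int r} \<times> {1..int r}))"
proof -
  let ?N = "{(x + 1, y), (x - 1, y), (x, y + 1), (x, y - 1), (x + 1, y - 1), (x - 1, y + 1)}
    \<inter> ({1..int r} \<times> {1..int r})"
  have D: "q - (x, y) \<in> hex_directions \<longleftrightarrow>
      q \<in> {(x + 1, y), (x - 1, y), (x, y + 1), (x, y - 1), (x + 1, y - 1), (x - 1, y + 1)}" for q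
    by (cases q, simp add: hex_directions_def) presburger
  have N: "?N = {q \<in> verts (hex_mesh r). q - (x, y) \<in> hex_directions}"
    unfolding D verts_hex_mesh by blast
  have "{e \<in> edges (hex_mesh r). (x, y) \<in> e} = (\<lambda>q. {(x, y), q}) ` ?N"
  proof (intro equalityI subsetI)
    fix e assume e: "e \<in> {e \<in> edges (hex_mesh r). (x, y) \<in> e}"
    then have "card e = 2" using simple_graph_hex_mesh[of r] by (auto simp: simple_graph_def)
    then obtain q where "e = {(x, y), q}" using e by (auto simp: card_2_iff)
    then show "e \<in> (\<lambda>q. {(x, y), q}) ` ?N" using e unfolding N by (auto simp: edge_hex_mesh_iff)
  next
    fix e assume "e \<in> (\<lambda>q. {(x, y), q}) ` ?N"
    then show "e \<in> {e \<in> edges (hex_mesh r). (x, y) \<in> e}"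
      using assms unfolding N by (auto simp: edge_hex_mesh_iff)
  qed
  then show ?thesis
    unfolding degree_def by (simp only:) (subst card_image, auto simp: inj_on_def doubleton_eq_iff)
qed

definition triangles_at :: "int \<Rightarrow> int \<times> int \<Rightarrow> nat" where
  "triangles_at n = (\<lambda>(x, y).
     if (x, y) \<in> {(1, 1), (n, n)} then 1
     else if (x, y) \<in> {(1, n), (n, 1)} then 2
     else if x \<in> {1, n} \<or> y \<in> {1, n} then 3 else 6)"

text \<open>The degree of the old vertex at a grid point in the derived network of side \<open>n\<close>: degree in the mesh plus twice
  \<open>triangles_at\<close>.\<close>

definition octahedral_degree :: "int \<Rightarrow> int \<times> int \<Rightarrow> nat" where
  "octahedral_degree n = (\<lambda>(x, y).
     if (x, y) \<in> {(1, 1), (n, n)} then 4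
     else if (x, y) \<in> {(1, n), (n, 1)} then 7
     else if x \<in> {1, n} \<or> y \<in> {1, n} then 10 else 18)"

lemma grid_line_cases:
  assumes "x \<in> {1..n :: int}"
  obtains "x = 1" | "x = n" "1 < n" | "1 < x" "x < n"
  using assms by force

lemma triangle_count_hex_mesh_eq:
  assumes r: "2 \<le> r" and p: "p \<in> verts (hex_mesh r)"
  shows "triangle_count (hex_mesh r) p = triangles_at (int r) p"
proof -
  obtain x y where xy: "p = (x, y)" by (cases p)
  have "x \<in> {1..int r}" "y \<in> {1..int r}" using p xy by (auto simp: verts_hex_mesh)
  then show ?thesis
    using r unfolding xy triangle_count_hex_mesh
    by (elim grid_line_cases) (simp_all add: triangles_at_def Int_insert_left)
qed

lemma degree_RHDN3_Old:
  assumes r: "2 \<le> r" and p: "p \<in> verts (hex_mesh r)"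
  shows "degree (RHDN3 r) (Old p) = octahedral_degree (int r) p"
proof -
  obtain x y where xy: "p = (x, y)" by (cases p)
  have "x \<in> {1..int r}" "y \<in> {1..int r}" using p xy by (auto simp: verts_hex_mesh)
  then show ?thesis
    using r
    unfolding RHDN3_def degree_Old[OF simple_graph_hex_mesh p] triangle_count_hex_mesh_eq[OF r p]
    unfolding xy degree_hex_mesh[OF p[unfolded xy]]
    by (elim grid_line_cases)
      (simp_all add: triangles_at_def octahedral_degree_def Int_insert_left)
qed

section \<open>Summation over grids\<close>

lemma sum_constant_between_ends:
  fixes f :: "int \<Rightarrow> real"
  assumes "2 \<le> n" and c: "\<And>i. 1 < i \<Longrightarrow> i < n \<Longrightarrow> f i = c"
  shows "sum f {1..n} = f 1 + f n + (of_int n - 2) * c"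
proof -
  have "{1..n} = insert 1 (insert n {1<..<n})" using assms(1) by auto
  then have "sum f {1..n} = f 1 + (f n + sum f {1<..<n})"
    using assms(1) by (simp add: sum.insert)
  also have "sum f {1<..<n} = (\<Sum>i\<in>{1<..<n}. c)" by (intro sum.cong) (auto simp: c)
  finally show ?thesis using assms(1) by (simp add: of_nat_nat)
qed

text \<open>The summand may take a separate value at each corner, but is constant along the interior of each
  side and on the interior of the grid. Splitting off the first and last term in both
  directions leaves constant sums.\<close>

lemma sum_grid:
  fixes g :: "int \<Rightarrow> int \<Rightarrow> real"
  assumes m: "2 \<le> m" and n: "2 \<le> n"
    and bottom: "\<And>x. 1 < x \<Longrightarrow> x < m \<Longrightarrow> g x 1 = b"
    and top: "\<And>x. 1 < x \<Longrightarrow> x < m \<Longrightarrow> g x n = t"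
    and left: "\<And>y. 1 < y \<Longrightarrow> y < n \<Longrightarrow> g 1 y = l"
    and right: "\<And>y. 1 < y \<Longrightarrow> y < n \<Longrightarrow> g m y = k"
    and inner: "\<And>x y. 1 < x \<Longrightarrow> x < m \<Longrightarrow> 1 < y \<Longrightarrow> y < n \<Longrightarrow> g x y = c"
  shows "(\<Sum>x\<in>{1..m}. \<Sum>y\<in>{1..n}. g x y) =
    g 1 1 + g 1 n + g m 1 + g m n
    + (of_int m - 2) * (b + t) + (of_int n - 2) * (l + k)
    + (of_int m - 2) * (of_int n - 2) * c"
proof -
  have "(\<Sum>y\<in>{1..n}. g x y) = b + t + (of_int n - 2) * c" if "1 < x" "x < m" for x
    using that by (subst sum_constant_between_ends[OF n, of _ c]) (auto simp: bottom top inner)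
  then have "(\<Sum>x\<in>{1..m}. \<Sum>y\<in>{1..n}. g x y) = (\<Sum>y\<in>{1..n}. g 1 y) + (\<Sum>y\<in>{1..n}. g m y)
      + (of_int m - 2) * (b + t + (of_int n - 2) * c)"
    by (rule sum_constant_between_ends[OF m])
  moreover have "(\<Sum>y\<in>{1..n}. g 1 y) = g 1 1 + g 1 n + (of_int n - 2) * l"
    by (rule sum_constant_between_ends[OF n left])
  moreover have "(\<Sum>y\<in>{1..n}. g m y) = g m 1 + g m n + (of_int n - 2) * k"
    by (rule sum_constant_between_ends[OF n right])
  ultimately show ?thesis by (simp add: algebra_simps)
qed

section \<open>The Balaban index\<close>

lemma inverse_roots:
  "1 / sqrt 7 = sqrt 7 / 7" "1 / sqrt 10 = sqrt 10 / 10" "1 / sqrt 18 = sqrt 2 / 6"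
  "1 / sqrt 40 = sqrt 10 / 20" "1 / sqrt 70 = sqrt 70 / 70" "1 / sqrt 126 = sqrt 14 / 42"
  "1 / sqrt 180 = sqrt 5 / (30::real)"
  by (rule power2_eq_imp_eq; simp add: power_divide)+

lemma sum_octahedral_degree_verts:
  assumes r: "2 \<le> r"
  shows "(\<Sum>a\<in>verts (hex_mesh r).
      real (triangles_at (int r) a) / sqrt (real (octahedral_degree (int r) a))) =
    1 + 4 / 7 * sqrt 7 + 6 / 5 * sqrt 10 * (real r - 2) + sqrt 2 * (real r - 2)\<^sup>2"
proof -
  let ?n = "int r"
  let ?g = "\<lambda>x y. real (triangles_at ?n (x, y)) / sqrt (real (octahedral_degree ?n (x, y)))"
  have corners: "?g 1 1 = 1 / 2" "?g ?n ?n = 1 / 2" "?g 1 ?n = 2 * (1 / sqrt 7)" "?g ?n 1 = 2 * (1 / sqrt 7)"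
    using r by (auto simp: triangles_at_def octahedral_degree_def)
  have "(\<Sum>a\<in>verts (hex_mesh r).
      real (triangles_at ?n a) / sqrt (real (octahedral_degree ?n a))) =
      (\<Sum>x\<in>{1..?n}. \<Sum>y\<in>{1..?n}. ?g x y)"
    by (simp add: verts_hex_mesh sum.cartesian_product case_prod_unfold)
  also have "\<dots> = ?g 1 1 + ?g 1 ?n + ?g ?n 1 + ?g ?n ?n
      + (of_int ?n - 2) * (3 * (1 / sqrt 10) + 3 * (1 / sqrt 10)) + (of_int ?n - 2) * (3 * (1 / sqrt 10) + 3 * (1 / sqrt 10))
      + (of_int ?n - 2) * (of_int ?n - 2) * (6 * (1 / sqrt 18))"
    by (rule sum_grid) (use r in \<open>auto simp: triangles_at_def octahedral_degree_def\<close>)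
  finally show ?thesis unfolding corners inverse_roots by (simp add: field_simps power2_eq_square)
qed

text \<open>One grid for each edge direction. Up to symmetry the edges have these degree pairs: \<open>(4, 10)\<close> and
  \<open>(7, 10)\<close> four times each, \<open>(7, 18)\<close> twice, \<open>(10, 10)\<close> for \<open>4 r - 10\<close> edges, namely
  \<open>4 (r - 3)\<close> on the boundary and one cutting off each corner of degree 4, \<open>(10, 18)\<close>
  for \<open>8 r - 20\<close> edges, and \<open>(18, 18)\<close> for the rest. An index range for edges ends at \<open>r - 1\<close> and
  has to contain two distinct ends, hence the bound on \<open>r\<close>.\<close>

lemma sum_octahedral_degree_edges:
  assumes r: "3 \<le> r"
  shows "(\<Sum>e\<in>edges (hex_mesh r). 1 / sqrt (\<Prod>p\<in>e. real (octahedral_degree (int r) p))) =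
    1 / 5 * sqrt 10 + 2 / 35 * sqrt 70 + 1 / 21 * sqrt 14 + (4 * real r - 10) / 10
    + sqrt 5 / 30 * (8 * real r - 20) + (3 * (real r)\<^sup>2 - 16 * real r + 21) / 18"
proof -
  define n where "n = int r"
  have n: "3 \<le> n" using r by (auto simp: n_def)
  let ?w = "\<lambda>p q. 1 / sqrt (real (octahedral_degree n p) * real (octahedral_degree n q))"
  have w: "1 / sqrt (\<Prod>p\<in>{p, q}. real (octahedral_degree n p)) = ?w p q" if "p \<noteq> q" for p q
    using that by simp
  have root: "sqrt 100 = (10::real)" "sqrt 324 = (18::real)"
    by (rule real_sqrt_unique; simp)+
  have corners: "?w (1, 1) (1 + 1, 1) = 1 / sqrt 40" "?w (1, n) (1 + 1, n) = 1 / sqrt 70"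
    "?w (n - 1, 1) (n - 1 + 1, 1) = 1 / sqrt 70" "?w (n - 1, n) (n - 1 + 1, n) = 1 / sqrt 40"
    "?w (1, 1) (1, 1 + 1) = 1 / sqrt 40" "?w (1, n - 1) (1, n - 1 + 1) = 1 / sqrt 70"
    "?w (n, 1) (n, 1 + 1) = 1 / sqrt 70" "?w (n, n - 1) (n, n - 1 + 1) = 1 / sqrt 40"
    "?w (1 + 1, 1) (1, 1 + 1) = 1 / 10" "?w (1 + 1, n - 1) (1, n - 1 + 1) = 1 / sqrt 126"
    "?w (n - 1 + 1, 1) (n - 1, 1 + 1) = 1 / sqrt 126"
    "?w (n - 1 + 1, n - 1) (n - 1, n - 1 + 1) = 1 / 10"
    using n by (auto simp: octahedral_degree_def root)
  have "(\<Sum>e\<in>edges (hex_mesh r). 1 / sqrt (\<Prod>p\<in>e. real (octahedral_degree n p))) =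
      (\<Sum>x\<in>{1..n - 1}. \<Sum>y\<in>{1..n}. ?w (x, y) (x + 1, y))
      + (\<Sum>x\<in>{1..n}. \<Sum>y\<in>{1..n - 1}. ?w (x, y) (x, y + 1))
      + (\<Sum>x\<in>{1..n - 1}. \<Sum>y\<in>{1..n - 1}. ?w (x + 1, y) (x, y + 1))"
    unfolding sum_edges_hex_mesh n_def[symmetric]
    by (intro arg_cong2[where f = "(+)"] sum.cong refl w) auto
  also have "(\<Sum>x\<in>{1..n - 1}. \<Sum>y\<in>{1..n}. ?w (x, y) (x + 1, y)) =
      ?w (1, 1) (1 + 1, 1) + ?w (1, n) (1 + 1, n) + ?w (n - 1, 1) (n - 1 + 1, 1)
      + ?w (n - 1, n) (n - 1 + 1, n)
      + (of_int (n - 1) - 2) * (1 / 10 + 1 / 10)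
      + (of_int n - 2) * (1 / sqrt 180 + 1 / sqrt 180)
      + (of_int (n - 1) - 2) * (of_int n - 2) * (1 / 18)"
    by (rule sum_grid) (use n in \<open>auto simp: octahedral_degree_def root\<close>)
  also have "(\<Sum>x\<in>{1..n}. \<Sum>y\<in>{1..n - 1}. ?w (x, y) (x, y + 1)) =
      ?w (1, 1) (1, 1 + 1) + ?w (1, n - 1) (1, n - 1 + 1) + ?w (n, 1) (n, 1 + 1)
      + ?w (n, n - 1) (n, n - 1 + 1)
      + (of_int n - 2) * (1 / sqrt 180 + 1 / sqrt 180)
      + (of_int (n - 1) - 2) * (1 / 10 + 1 / 10)
      + (of_int n - 2) * (of_int (n - 1) - 2) * (1 / 18)"
    by (rule sum_grid) (use n in \<open>auto simp: octahedral_degree_def root\<close>)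
  also have "(\<Sum>x\<in>{1..n - 1}. \<Sum>y\<in>{1..n - 1}. ?w (x + 1, y) (x, y + 1)) =
      ?w (1 + 1, 1) (1, 1 + 1) + ?w (1 + 1, n - 1) (1, n - 1 + 1)
      + ?w (n - 1 + 1, 1) (n - 1, 1 + 1) + ?w (n - 1 + 1, n - 1) (n - 1, n - 1 + 1)
      + (of_int (n - 1) - 2) * (1 / sqrt 180 + 1 / sqrt 180)
      + (of_int (n - 1) - 2) * (1 / sqrt 180 + 1 / sqrt 180)
      + (of_int (n - 1) - 2) * (of_int (n - 1) - 2) * (1 / 18)"
    by (rule sum_grid) (use n in \<open>auto simp: octahedral_degree_def root\<close>)
  finally show ?thesis
    unfolding corners inverse_roots unfolding n_def by (simp add: field_simps power2_eq_square)
qed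

lemma card_edges_hex_mesh:
  assumes "1 \<le> r"
  shows "real (card (edges (hex_mesh r))) = 3 * (real r)\<^sup>2 - 4 * real r + 1"
proof -
  obtain k where "r = Suc k" using assms by (cases r) auto
  then have "card (edges (hex_mesh r)) = k * r + r * k + k * k"
    unfolding card_eq_sum sum_edges_hex_mesh by (simp add: nat_add_distrib)
  then show ?thesis using \<open>r = Suc k\<close> by (simp add: algebra_simps power2_eq_square)
qed

theorem theorem2p3p2:
  fixes r :: nat
  assumes "4 \<le> r"
  shows "balaban_index (RHDN3 r) =
    (19 - 40 * real r + 21 * (real r)^2) / (315 * (15 - 28 * real r + 14 * (real r)^2)) *
    (3 * (280 + 420 * sqrt 2 - 70 * sqrt 5 + 60 * sqrt 7 - 231 * sqrt 10
            + 5 * sqrt 14 + 6 * sqrt 70)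
     + 7 * (- 157 - 180 * sqrt 2 + 12 * sqrt 5 + 54 * sqrt 10) * real r
     + 105 * (5 + 3 * sqrt 2) * (real r)^2)"
proof -
  let ?G = "hex_mesh r"
  have simple: "simple_graph ?G" by (rule simple_graph_hex_mesh)
  have T: "real (card (triangles ?G)) = 2 * (real r - 1)\<^sup>2"
    using assms by (simp add: card_triangles_hex_mesh of_nat_diff)
  have V: "card (verts ?G) = r\<^sup>2"
    by (simp add: verts_hex_mesh power2_eq_square)
  have E: "real (card (edges (RHDN3 r))) = 19 - 40 * real r + 21 * (real r)\<^sup>2"
    using assms T card_edges_hex_mesh[of r]
    by (simp add: RHDN3_def card_edges_octahedral_derived[OF simple] algebra_simps power2_eq_square)
  have EV: "real (card (edges (RHDN3 r))) - real (card (verts (RHDN3 r))) + 2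
      = 15 - 28 * real r + 14 * (real r)\<^sup>2"
    unfolding E using T V
    by (simp add: RHDN3_def card_verts_octahedral_derived[OF simple] algebra_simps power2_eq_square)
  have S: "(\<Sum>e\<in>edges (RHDN3 r). 1 / sqrt (\<Prod>p\<in>e. real (degree (RHDN3 r) p))) =
      (3 * (280 + 420 * sqrt 2 - 70 * sqrt 5 + 60 * sqrt 7 - 231 * sqrt 10
            + 5 * sqrt 14 + 6 * sqrt 70)
       + 7 * (- 157 - 180 * sqrt 2 + 12 * sqrt 5 + 54 * sqrt 10) * real r
       + 105 * (5 + 3 * sqrt 2) * (real r)\<^sup>2) / 315"
  proof -
    have deg: "degree (octahedral_derived ?G) (Old a) = octahedral_degree (int r) a"
      if "a \<in> verts ?G" for a
      using degree_RHDN3_Old[OF _ that] assms by (simp add: RHDN3_def)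
    have "(\<Sum>e\<in>edges (RHDN3 r). 1 / sqrt (\<Prod>p\<in>e. real (degree (RHDN3 r) p))) =
        (\<Sum>e\<in>edges ?G. 1 / sqrt (\<Prod>p\<in>e. real (octahedral_degree (int r) p)))
        + (\<Sum>a\<in>verts ?G. real (triangle_count ?G a) / sqrt (real (octahedral_degree (int r) a)))
        + 3 / 4 * real (card (triangles ?G))"
      unfolding RHDN3_def by (rule sum_edges_balaban_octahedral_derived[OF simple]) (rule deg)
    also have "(\<Sum>a\<in>verts ?G. real (triangle_count ?G a) / sqrt (real (octahedral_degree (int r) a)))
        = (\<Sum>a\<in>verts ?G. real (triangles_at (int r) a) / sqrt (real (octahedral_degree (int r) a)))"
      using assms by (intro sum.cong) (auto simp: triangle_count_hex_mesh_eq)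
    also note sum_octahedral_degree_verts
    also note sum_octahedral_degree_edges
    finally show ?thesis using assms by (simp add: T field_simps power2_eq_square)
  qed
  show ?thesis unfolding balaban_index_def EV S unfolding E by simp
qed

end
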